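(* Let $s\in\mathbb N$ with $s>(d+1)/2+1$ and let $\phi\in H^{s+\frac12}(\mathbb T^d)$ with $\min_{\mathbb T^d}(-\phi)>-gb$. Let $\eta_*$ be the solution of $\sigma\mathcal H(\eta_* )+g\eta_*=-\phi$, and let $\delta_0=\delta_0(\|\phi\|_{H^{s-\frac12}})$, $\gamma_\delta$, $\gamma^\dagger$, $\omega$ be the quantities described in the context. Then any traveling wave solution $\eta_w$, with speed $\gamma$, of the free boundary Stokes equations given by fact (E) of the context is asymptotically stable in $\mathring H^{s+1}(\mathbb T^d)$ provided $$\begin{cases}\|\eta_w-\eta_*\|_{H^{s+\frac32}}<\delta<\min\Big\{\delta_0(\|\phi\|_{H^{s-\frac12}}),\ \omega\big(\delta_0(\|\phi\|_{H^{s-\frac12}})+\|\eta_*\|_{H^{s+\frac32}}\big)\Big\},\\ |\gamma|<\min\{\gamma_\delta,\gamma^\dagger\}.\end{cases}$$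
   Context: $\mathbb T^d=(\mathbb R/2\pi\mathbb Z)^d$; $b,g,\sigma>0$ fixed. For $\eta:\mathbb T^d\to(-b,\infty)$: $\Omega_\eta=\{(x,y)\in\mathbb T^d\times\mathbb R:-b<y<\eta(x)\}$, $\Sigma_\eta=\{y=\eta(x)\}$, $\Sigma_{-b}=\{y=-b\}$, $\mathcal N=(-\nabla\eta,1)$, $\mathbb Dv=\nabla v+(\nabla v)^T$, $\mathcal H(\eta)=-\mathrm{div}(\nabla\eta/\sqrt{1+|\nabla\eta|^2})$. $\mathring H^r(\mathbb T^d)$: mean-zero functions in $H^r(\mathbb T^d)$. ${}_0H^{s+1}_\sigma(\Omega_\eta)$: divergence-free vector fields in $H^{s+1}(\Omega_\eta;\mathbb R^{d+1})$ vanishing on $\Sigma_{-b}$. $\Psi_0[\eta]\chi=v(\cdot,\eta(\cdot))\cdot\mathcal N$, where $(v,p)$ is the unique (weak) solution of $-\Delta v+\nabla p=0$, $\nabla\cdot v=0$ in $\Omega_\eta$, $(pI-\mathbb Dv)(\cdot,\eta(\cdot))\mathcal N=\chi\mathcal N$ on $\mathbb T^d$, $v=0$ on $\Sigma_{-b}$. In the frame moving with speed $\gamma$ in direction $x_1$, the dynamic free boundary Stokes problem with external stress $\phi I$ is $\partial_t\eta=\gamma\partial_1\eta+\Psi_0[\eta](\sigma\mathcal H(\eta)+g\eta+\phi)$; a traveling wave with speed $\gamma$ is a time-independent solution. "$\eta_w$ is asymptotically stable in $\mathring H^{s+1}$" means: there are $\varepsilon,M,c>0$ such that for every $f_0\in\mathring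 H^{s+1}(\mathbb T^d)$ with $\|f_0\|_{H^{s+1}}\le\varepsilon$ there is a unique solution $\eta=\eta_w+f$ of the dynamic problem with $\eta|_{t=0}=\eta_w+f_0$ and $f\in C([0,T];\mathring H^{s+1})\cap L^2([0,T];H^{s+\frac32})$ for all $T>0$, and $\|f(t)\|_{H^{s+1}}\le Me^{-ct}\|f_0\|_{H^{s+1}}$ for all $t>0$. Two facts fixing the constants (established separately in the source): (E) There is $\delta_0>0$, depending on $\|\phi\|_{H^{s-\frac12}}$ (which controls $\|\phi\|_{C^1}$ for the present range of $s$), such that for every $\delta\in(0,\delta_0)$ there is $\gamma_\delta>0$ such that for all $|\gamma|<\gamma_\delta$ the traveling wave system for the Stokes equations ($-\Delta v+\nabla p=0$, $\nabla\cdot v=0$ in $\Omega_{\eta_w}$; $(pI-\mathbb Dv)\mathcal N=(\sigma\mathcal H(\eta_w)+g\eta_w+\phi)\mathcal N$ and $v\cdot\mathcal N=-\gamma\partial_1\eta_w$ on $\Sigma_{\eta_w}$; $v=0$ on $\Sigma_{-b}$) has a unique solution $(v,p,\eta_w)$ in the ball of radius $\delta$ centered at $(0,0,\eta_* )$ in ${}_0H^{s+1}_\sigma(\Omega_{\eta_w})\times H^s(\Omega_{\eta_w})\times H^{s+\frac32}(\mathbb T^d)$. (S) There are $\gamma^\dagger>0$ and a nonincreasing function $\omega:\mathbb R_+\to\mathbb R_+$, both depending on $\eta_*\in H^{s+\frac52}(\mathbb T^d)$, such that every traveling wave solution $\eta_w\in H^{s+\frac32}(\mathbb T^d)$ of the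 free boundary Stokes equations with speed $\gamma\in(-\gamma^\dagger,\gamma^\dagger)$ and $\|\eta_w-\eta_*\|_{H^{s+\frac32}}\le\omega(\|\eta_w\|_{H^{s+\frac32}})$ is asymptotically stable with respect to perturbations in $\mathring H^{s+1}(\mathbb T^d)$. Since $\phi\in H^{s+\frac12}(\mathbb T^d)$, one has $\eta_*\in H^{s+\frac52}(\mathbb T^d)$. *)

theory Defs
  imports "HOL-Analysis.Analysis"
begin

text \<open>
  The dimension \<open>d\<close> is \<open>CARD('n)\<close>. A function on the torus is a function on \<open>real ^ 'n\<close> that is
  \<open>2 * pi\<close>-periodic in every coordinate; a function on \<open>\<Omega>\<^sub>\<eta>\<close> is a function on the lifted domain
  in \<open>(real ^ 'n) \<times> real\<close>, periodic in the first component. Integrals over the torus and over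
  \<open>\<Omega>\<^sub>\<eta>\<close> are integrals over one period cell. Vector fields with \<open>d + 1\<close> components take values in
  \<open>(real ^ 'n) \<times> real\<close>, and their scalar components are indexed by \<open>Basis\<close>.
\<close>

section \<open>Sobolev spaces on the torus\<close>

definition periodic :: "(real ^ 'n \<Rightarrow> real) \<Rightarrow> bool" where
  "periodic f \<longleftrightarrow> (\<forall>x i. f (x + (2 * pi) *\<^sub>R axis i 1) = f x)"

definition cell :: "(real ^ 'n) set" where
  "cell = cbox 0 (\<chi> i. 2 * pi)"

definition freq :: "int ^ 'n \<Rightarrow> real ^ 'n" where
  "freq k = (\<chi> i. real_of_int (k $ i))"

definition fourier_coeff :: "(real ^ 'n \<Rightarrow> real) \<Rightarrow> int ^ 'n \<Rightarrow> complex" where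
  "fourier_coeff f k =
     (LINT x|lebesgue_on cell. complex_of_real (f x) * cis (- (freq k \<bullet> x))) / (2 * pi) ^ CARD('n)"

definition sobolev_weight :: "real \<Rightarrow> (real ^ 'n \<Rightarrow> real) \<Rightarrow> int ^ 'n \<Rightarrow> real" where
  "sobolev_weight r f k = (1 + (norm (freq k))\<^sup>2) powr r * (cmod (fourier_coeff f k))\<^sup>2"

text \<open>\<open>H\<^sup>r\<close> of the torus, for \<open>r \<ge> 0\<close>.\<close>

definition sobolev_torus :: "real \<Rightarrow> (real ^ 'n \<Rightarrow> real) set" where
  "sobolev_torus r =
     {f. periodic f \<and> f \<in> borel_measurable lebesgue \<and>
         integrable (lebesgue_on cell) (\<lambda>x. (f x)\<^sup>2) \<and>
         sobolev_weight r f summable_on UNIV}"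

definition norm_torus :: "real \<Rightarrow> (real ^ 'n \<Rightarrow> real) \<Rightarrow> real" where
  "norm_torus r f = sqrt (\<Sum>\<^sub>\<infinity>k\<in>UNIV. sobolev_weight r f k)"

text \<open>
  For \<open>r > d / 2\<close> every class in \<open>H\<^sup>r\<close> has exactly one continuous representative. All orders
  at which functions on the torus are used below are larger than \<open>d / 2 + 2\<close>, so that
  these representatives are of class \<open>C\<^sup>2\<close> and their derivatives can be taken classically.
\<close>

definition sobolev_torus_cont :: "real \<Rightarrow> (real ^ 'n \<Rightarrow> real) set" where
  "sobolev_torus_cont r = {f \<in> sobolev_torus r. continuous_on UNIV f}"

definition mean_torus :: "(real ^ 'n \<Rightarrow> real) \<Rightarrow> real" where
  "mean_torus f = (LINT x|lebesgue_on cell. f x) / (2 * pi) ^ CARD('n)"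

definition sobolev_torus_mean0 :: "real \<Rightarrow> (real ^ 'n \<Rightarrow> real) set" where
  "sobolev_torus_mean0 r = {f \<in> sobolev_torus_cont r. mean_torus f = 0}"

section \<open>Geometry of the free surface\<close>

definition pd :: "'n \<Rightarrow> (real ^ 'n \<Rightarrow> real) \<Rightarrow> real ^ 'n \<Rightarrow> real" where
  "pd i f x = frechet_derivative f (at x) (axis i 1)"

definition grad :: "(real ^ 'n \<Rightarrow> real) \<Rightarrow> real ^ 'n \<Rightarrow> real ^ 'n" where
  "grad f x = (\<chi> i. pd i f x)"

definition mean_curv :: "(real ^ 'n \<Rightarrow> real) \<Rightarrow> real ^ 'n \<Rightarrow> real" where
  "mean_curv \<eta> x =
     - (\<Sum>i\<in>UNIV. pd i (\<lambda>z. grad \<eta> z $ i / sqrt (1 + (norm (grad \<eta> z))\<^sup>2)) x)"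

definition normal_vec :: "(real ^ 'n \<Rightarrow> real) \<Rightarrow> real ^ 'n \<Rightarrow> (real ^ 'n) \<times> real" where
  "normal_vec \<eta> x = (- grad \<eta> x, 1)"

definition Omega :: "real \<Rightarrow> (real ^ 'n \<Rightarrow> real) \<Rightarrow> ((real ^ 'n) \<times> real) set" where
  "Omega b \<eta> = {(x, y). - b < y \<and> y < \<eta> x}"

definition Omega_cell :: "real \<Rightarrow> (real ^ 'n \<Rightarrow> real) \<Rightarrow> ((real ^ 'n) \<times> real) set" where
  "Omega_cell b \<eta> = Omega b \<eta> \<inter> (cell \<times> UNIV)"

section \<open>Weak derivatives and Sobolev spaces of integer order on \<open>\<Omega>\<^sub>\<eta>\<close>\<close>

primrec Ck :: "nat \<Rightarrow> ('a::euclidean_space \<Rightarrow> real) \<Rightarrow> bool" where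
  "Ck 0 f \<longleftrightarrow> continuous_on UNIV f"
| "Ck (Suc k) f \<longleftrightarrow> (\<forall>x. f differentiable (at x)) \<and>
     (\<forall>e\<in>Basis. Ck k (\<lambda>x. frechet_derivative f (at x) e))"

definition smooth :: "('a::euclidean_space \<Rightarrow> real) \<Rightarrow> bool" where
  "smooth f \<longleftrightarrow> (\<forall>k. Ck k f)"

definition test_function :: "'a::euclidean_space set \<Rightarrow> ('a \<Rightarrow> real) \<Rightarrow> bool" where
  "test_function U \<psi> \<longleftrightarrow>
     smooth \<psi> \<and> compact (closure {z. \<psi> z \<noteq> 0}) \<and> closure {z. \<psi> z \<noteq> 0} \<subseteq> U"

definition locally_integrable :: "'a::euclidean_space set \<Rightarrow> ('a \<Rightarrow> real) \<Rightarrow> bool" where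
  "locally_integrable U u \<longleftrightarrow> (\<forall>K. compact K \<and> K \<subseteq> U \<longrightarrow> integrable (lebesgue_on K) u)"

definition has_weak_deriv ::
    "'a::euclidean_space set \<Rightarrow> 'a \<Rightarrow> ('a \<Rightarrow> real) \<Rightarrow> ('a \<Rightarrow> real) \<Rightarrow> bool" where
  "has_weak_deriv U e u h \<longleftrightarrow>
     locally_integrable U u \<and> locally_integrable U h \<and>
     (\<forall>\<psi>. test_function U \<psi> \<longrightarrow>
        (LINT z|lebesgue_on U. u z * frechet_derivative \<psi> (at z) e) =
        - (LINT z|lebesgue_on U. h z * \<psi> z))"

text \<open>The weak derivative is determined up to null sets; all uses below respect this.\<close>

definition wd ::
    "real \<Rightarrow> (real ^ 'n \<Rightarrow> real) \<Rightarrow> (real ^ 'n) \<times> real \<Rightarrow> ((real ^ 'n) \<times> real \<Rightarrow> real)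
      \<Rightarrow> (real ^ 'n) \<times> real \<Rightarrow> real" where
  "wd b \<eta> e u = (SOME h. has_weak_deriv (Omega b \<eta>) e u h)"

definition L2_Omega ::
    "real \<Rightarrow> (real ^ 'n \<Rightarrow> real) \<Rightarrow> ((real ^ 'n) \<times> real \<Rightarrow> real) \<Rightarrow> bool" where
  "L2_Omega b \<eta> u \<longleftrightarrow>
     u \<in> borel_measurable (lebesgue_on (Omega_cell b \<eta>)) \<and>
     integrable (lebesgue_on (Omega_cell b \<eta>)) (\<lambda>z. (u z)\<^sup>2)"

primrec weakly_diff_L2 ::
    "real \<Rightarrow> (real ^ 'n \<Rightarrow> real) \<Rightarrow> nat \<Rightarrow> ((real ^ 'n) \<times> real \<Rightarrow> real) \<Rightarrow> bool" where
  "weakly_diff_L2 b \<eta> 0 u \<longleftrightarrow> L2_Omega b \<eta> u"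
| "weakly_diff_L2 b \<eta> (Suc k) u \<longleftrightarrow> L2_Omega b \<eta> u \<and>
     (\<forall>e\<in>Basis. (\<exists>h. has_weak_deriv (Omega b \<eta>) e u h) \<and> weakly_diff_L2 b \<eta> k (wd b \<eta> e u))"

text \<open>
  The squared \<open>H\<^sup>k\<close> norm is the sum over \<open>j \<le> k\<close> of the squared \<open>L\<^sup>2\<close> norms of the tensors of
  \<open>j\<close>-th order derivatives.
\<close>

primrec norm_Omega_sq ::
    "real \<Rightarrow> (real ^ 'n \<Rightarrow> real) \<Rightarrow> nat \<Rightarrow> ((real ^ 'n) \<times> real \<Rightarrow> real) \<Rightarrow> real" where
  "norm_Omega_sq b \<eta> 0 u = (LINT z|lebesgue_on (Omega_cell b \<eta>). (u z)\<^sup>2)"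
| "norm_Omega_sq b \<eta> (Suc k) u = (LINT z|lebesgue_on (Omega_cell b \<eta>). (u z)\<^sup>2) +
     (\<Sum>e\<in>Basis. norm_Omega_sq b \<eta> k (wd b \<eta> e u))"

definition sobolev_Omega ::
    "real \<Rightarrow> (real ^ 'n \<Rightarrow> real) \<Rightarrow> nat \<Rightarrow> ((real ^ 'n) \<times> real \<Rightarrow> real) set" where
  "sobolev_Omega b \<eta> k =
     {u. (\<forall>x y i. (x, y) \<in> Omega b \<eta> \<longrightarrow> u (x + (2 * pi) *\<^sub>R axis i 1, y) = u (x, y)) \<and>
         weakly_diff_L2 b \<eta> k u}"

definition norm_Omega ::
    "real \<Rightarrow> (real ^ 'n \<Rightarrow> real) \<Rightarrow> nat \<Rightarrow> ((real ^ 'n) \<times> real \<Rightarrow> real) \<Rightarrow> real" where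
  "norm_Omega b \<eta> k u = sqrt (norm_Omega_sq b \<eta> k u)"

definition norm_Omega_vec ::
    "real \<Rightarrow> (real ^ 'n \<Rightarrow> real) \<Rightarrow> nat \<Rightarrow> ((real ^ 'n) \<times> real \<Rightarrow> (real ^ 'n) \<times> real) \<Rightarrow> real" where
  "norm_Omega_vec b \<eta> k v = sqrt (\<Sum>e\<in>Basis. norm_Omega_sq b \<eta> k (\<lambda>z. v z \<bullet> e))"

text \<open>
  Traces as limits of vertical averages. For \<open>u\<close> in \<open>H\<^sup>1\<close> the limits exist for almost every
  \<open>x\<close>, do not depend on the representative, and equal the usual trace; for \<open>u\<close>
  continuous up to the boundary they are the boundary values.
\<close>

definition trace_top ::
    "(real ^ 'n \<Rightarrow> real) \<Rightarrow> ((real ^ 'n) \<times> real \<Rightarrow> (real ^ 'n) \<times> real) \<Rightarrow> real ^ 'n \<Rightarrow> (real ^ 'n) \<times> real"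
  where
  "trace_top \<eta> u x =
     Lim (at_right 0) (\<lambda>h. (1 / h) *\<^sub>R (LINT y|lebesgue_on {\<eta> x - h..\<eta> x}. u (x, y)))"

definition vanishes_at_bottom ::
    "real \<Rightarrow> ((real ^ 'n) \<times> real \<Rightarrow> (real ^ 'n) \<times> real) \<Rightarrow> bool" where
  "vanishes_at_bottom b u \<longleftrightarrow>
     (AE x in lebesgue.
        ((\<lambda>h. (1 / h) *\<^sub>R (LINT y|lebesgue_on {- b..- b + h}. u (x, y))) \<longlongrightarrow> 0) (at_right 0))"

definition sobolev0_Omega ::
    "real \<Rightarrow> (real ^ 'n \<Rightarrow> real) \<Rightarrow> nat \<Rightarrow> ((real ^ 'n) \<times> real \<Rightarrow> (real ^ 'n) \<times> real) set" where
  "sobolev0_Omega b \<eta> k =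
     {v. (\<forall>e\<in>Basis. (\<lambda>z. v z \<bullet> e) \<in> sobolev_Omega b \<eta> k) \<and> vanishes_at_bottom b v}"

definition divg ::
    "real \<Rightarrow> (real ^ 'n \<Rightarrow> real) \<Rightarrow> ((real ^ 'n) \<times> real \<Rightarrow> (real ^ 'n) \<times> real)
      \<Rightarrow> (real ^ 'n) \<times> real \<Rightarrow> real" where
  "divg b \<eta> v z = (\<Sum>e\<in>Basis. wd b \<eta> e (\<lambda>q. v q \<bullet> e) z)"

text \<open>The space of divergence-free fields in \<open>H\<^sup>k\<close> vanishing on the bottom.\<close>

definition sobolev0_sigma ::
    "real \<Rightarrow> (real ^ 'n \<Rightarrow> real) \<Rightarrow> nat \<Rightarrow> ((real ^ 'n) \<times> real \<Rightarrow> (real ^ 'n) \<times> real) set" where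
  "sobolev0_sigma b \<eta> k =
     {v \<in> sobolev0_Omega b \<eta> k. AE z in lebesgue_on (Omega b \<eta>). divg b \<eta> v z = 0}"

section \<open>The Stokes problem and its normal-stress to normal-velocity map\<close>

definition sym_grad ::
    "real \<Rightarrow> (real ^ 'n \<Rightarrow> real) \<Rightarrow> ((real ^ 'n) \<times> real \<Rightarrow> (real ^ 'n) \<times> real)
      \<Rightarrow> (real ^ 'n) \<times> real \<Rightarrow> (real ^ 'n) \<times> real \<Rightarrow> (real ^ 'n) \<times> real \<Rightarrow> real" where
  "sym_grad b \<eta> v e e' z = wd b \<eta> e (\<lambda>q. v q \<bullet> e') z + wd b \<eta> e' (\<lambda>q. v q \<bullet> e) z"

text \<open>
  Weak solutions of \<open>- \<Delta> v + \<nabla> p = 0\<close> and \<open>\<nabla> \<cdot> v = 0\<close> in \<open>\<Omega>\<^sub>\<eta>\<close> with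
  \<open>(p I - D v) N = \<kappa> N\<close> on the surface and \<open>v = 0\<close> on the bottom. Since \<open>v\<close> is
  divergence-free, \<open>- \<Delta> v + \<nabla> p\<close> is the divergence of \<open>p I - D v\<close>, and testing
  with \<open>w\<close> gives the integral of \<open>D v : \<nabla> w - p \<nabla> \<cdot> w\<close> on the left-hand side. On the
  right-hand side the non-normalised vector \<open>N\<close> already contains the surface element.
\<close>

definition stokes_solution ::
    "real \<Rightarrow> (real ^ 'n \<Rightarrow> real) \<Rightarrow> (real ^ 'n \<Rightarrow> real) \<Rightarrow>
     ((real ^ 'n) \<times> real \<Rightarrow> (real ^ 'n) \<times> real) \<Rightarrow> ((real ^ 'n) \<times> real \<Rightarrow> real) \<Rightarrow> bool" where
  "stokes_solution b \<eta> \<kappa> v p \<longleftrightarrow>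
     v \<in> sobolev0_sigma b \<eta> 1 \<and> p \<in> sobolev_Omega b \<eta> 0 \<and>
     (\<forall>w \<in> sobolev0_Omega b \<eta> 1.
        (LINT z|lebesgue_on (Omega_cell b \<eta>).
           (\<Sum>e\<in>Basis. \<Sum>e'\<in>Basis. sym_grad b \<eta> v e e' z * wd b \<eta> e (\<lambda>q. w q \<bullet> e') z)
           - p z * divg b \<eta> w z) =
        - (LINT x|lebesgue_on cell. \<kappa> x * (normal_vec \<eta> x \<bullet> trace_top \<eta> w x)))"

text \<open>
  The graph of the operator \<open>\<Psi>\<^sub>0[\<eta>]\<close>: \<open>is_Psi0 b \<eta> \<kappa> \<psi>\<close> means \<open>\<Psi>\<^sub>0[\<eta>] \<kappa> = \<psi>\<close>.
\<close>

definition is_Psi0 ::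
    "real \<Rightarrow> (real ^ 'n \<Rightarrow> real) \<Rightarrow> (real ^ 'n \<Rightarrow> real) \<Rightarrow> (real ^ 'n \<Rightarrow> real) \<Rightarrow> bool" where
  "is_Psi0 b \<eta> \<kappa> \<psi> \<longleftrightarrow>
     (\<exists>v p. stokes_solution b \<eta> \<kappa> v p \<and>
            (AE x in lebesgue. \<psi> x = trace_top \<eta> v x \<bullet> normal_vec \<eta> x))"

section \<open>The dynamic problem, traveling waves and stability\<close>

definition surface_stress ::
    "real \<Rightarrow> real \<Rightarrow> (real ^ 'n \<Rightarrow> real) \<Rightarrow> (real ^ 'n \<Rightarrow> real) \<Rightarrow> real ^ 'n \<Rightarrow> real" where
  "surface_stress g \<sigma> \<phi> \<eta> x = \<sigma> * mean_curv \<eta> x + g * \<eta> x + \<phi> x"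

text \<open>
  \<open>\<partial>\<^sub>t \<eta> = \<gamma> \<partial>\<^sub>1 \<eta> + \<Psi>\<^sub>0[\<eta>](\<sigma> H(\<eta>) + g \<eta> + \<phi>)\<close> on \<open>[0, T]\<close>, where \<open>G\<close> is
  the right-hand side, given for almost every time, and \<open>\<eta>(t) = \<eta>(0) + \<integral>\<^sub>0\<^sup>t G\<close> is tested
  with smooth functions on the torus. Mere differentiability at almost every time would not be
  enough, since it does not make \<open>\<eta>\<close> the integral of its time derivative. The index
  \<open>i1\<close> is the direction of propagation.
\<close>

definition dynamic_solution ::
    "real \<Rightarrow> real \<Rightarrow> real \<Rightarrow> 'n \<Rightarrow> (real ^ 'n \<Rightarrow> real) \<Rightarrow> real \<Rightarrow> real
      \<Rightarrow> (real \<Rightarrow> real ^ 'n \<Rightarrow> real) \<Rightarrow> bool" where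
  "dynamic_solution b g \<sigma> i1 \<phi> \<gamma> T \<eta> \<longleftrightarrow>
     (\<forall>t\<in>{0..T}. \<forall>x. - b < \<eta> t x) \<and>
     (\<exists>G :: real \<Rightarrow> real ^ 'n \<Rightarrow> real.
        (AE t in lebesgue_on {0..T}. \<exists>\<psi>.
            is_Psi0 b (\<eta> t) (surface_stress g \<sigma> \<phi> (\<eta> t)) \<psi> \<and>
            (\<forall>x. G t x = \<gamma> * pd i1 (\<eta> t) x + \<psi> x)) \<and>
        (\<forall>\<theta>. smooth \<theta> \<and> periodic \<theta> \<longrightarrow>
            integrable (lebesgue_on {0..T}) (\<lambda>\<tau>. LINT x|lebesgue_on cell. G \<tau> x * \<theta> x) \<and>
            (\<forall>t\<in>{0..T}.
               (LINT x|lebesgue_on cell. \<eta> t x * \<theta> x) =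
               (LINT x|lebesgue_on cell. \<eta> 0 x * \<theta> x) +
               (LINT \<tau>|lebesgue_on {0..t}. LINT x|lebesgue_on cell. G \<tau> x * \<theta> x))))"

definition traveling_wave ::
    "real \<Rightarrow> real \<Rightarrow> real \<Rightarrow> 'n \<Rightarrow> (real ^ 'n \<Rightarrow> real) \<Rightarrow> real \<Rightarrow> (real ^ 'n \<Rightarrow> real) \<Rightarrow> bool" where
  "traveling_wave b g \<sigma> i1 \<phi> \<gamma> \<eta> \<longleftrightarrow> (\<forall>T>0. dynamic_solution b g \<sigma> i1 \<phi> \<gamma> T (\<lambda>t. \<eta>))"

text \<open>\<open>f \<in> C([0, T]; H\<^sup>s\<^sup>+\<^sup>1) \<inter> L\<^sup>2([0, T]; H\<^sup>s\<^sup>+\<^sup>3\<^sup>/\<^sup>2)\<close> with mean-zero values.\<close>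

definition perturbation_class :: "nat \<Rightarrow> real \<Rightarrow> (real \<Rightarrow> real ^ 'n \<Rightarrow> real) \<Rightarrow> bool" where
  "perturbation_class s T f \<longleftrightarrow>
     (\<forall>t\<in>{0..T}. f t \<in> sobolev_torus_mean0 (real s + 1)) \<and>
     (\<forall>t\<in>{0..T}.
        ((\<lambda>\<tau>. norm_torus (real s + 1) (\<lambda>x. f \<tau> x - f t x)) \<longlongrightarrow> 0) (at t within {0..T})) \<and>
     (AE t in lebesgue_on {0..T}. f t \<in> sobolev_torus (real s + 3/2)) \<and>
     integrable (lebesgue_on {0..T}) (\<lambda>t. (norm_torus (real s + 3/2) (f t))\<^sup>2)"

definition perturbed_solution ::
    "real \<Rightarrow> real \<Rightarrow> real \<Rightarrow> 'n \<Rightarrow> nat \<Rightarrow> (real ^ 'n \<Rightarrow> real) \<Rightarrow> real \<Rightarrow> (real ^ 'n \<Rightarrow> real)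
      \<Rightarrow> (real ^ 'n \<Rightarrow> real) \<Rightarrow> (real \<Rightarrow> real ^ 'n \<Rightarrow> real) \<Rightarrow> bool" where
  "perturbed_solution b g \<sigma> i1 s \<phi> \<gamma> \<eta>w f0 f \<longleftrightarrow>
     f 0 = f0 \<and>
     (\<forall>T>0. perturbation_class s T f \<and>
            dynamic_solution b g \<sigma> i1 \<phi> \<gamma> T (\<lambda>t x. \<eta>w x + f t x))"

definition asymptotically_stable ::
    "real \<Rightarrow> real \<Rightarrow> real \<Rightarrow> 'n \<Rightarrow> nat \<Rightarrow> (real ^ 'n \<Rightarrow> real) \<Rightarrow> real \<Rightarrow> (real ^ 'n \<Rightarrow> real) \<Rightarrow> bool"
  where
  "asymptotically_stable b g \<sigma> i1 s \<phi> \<gamma> \<eta>w \<longleftrightarrow>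
     (\<exists>\<epsilon>>0. \<exists>M>0. \<exists>c>0.
        \<forall>f0 \<in> sobolev_torus_mean0 (real s + 1). norm_torus (real s + 1) f0 \<le> \<epsilon> \<longrightarrow>
          (\<exists>f. perturbed_solution b g \<sigma> i1 s \<phi> \<gamma> \<eta>w f0 f \<and>
               (\<forall>f'. perturbed_solution b g \<sigma> i1 s \<phi> \<gamma> \<eta>w f0 f' \<longrightarrow> (\<forall>t\<ge>0. f' t = f t)) \<and>
               (\<forall>t>0. norm_torus (real s + 1) (f t)
                        \<le> M * exp (- c * t) * norm_torus (real s + 1) f0)))"

section \<open>Existence and stability of traveling waves near the equilibrium\<close>

text \<open>
  The traveling wave system. For \<open>v\<close> in \<open>H\<^sup>s\<^sup>+\<^sup>1\<close> and \<open>p\<close> in \<open>H\<^sup>s\<close> weak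
  solutions of the Stokes problem are strong solutions.
\<close>

definition tw_system ::
    "real \<Rightarrow> real \<Rightarrow> real \<Rightarrow> 'n \<Rightarrow> nat \<Rightarrow> (real ^ 'n \<Rightarrow> real) \<Rightarrow> real \<Rightarrow>
     ((real ^ 'n) \<times> real \<Rightarrow> (real ^ 'n) \<times> real) \<Rightarrow> ((real ^ 'n) \<times> real \<Rightarrow> real) \<Rightarrow> (real ^ 'n \<Rightarrow> real) \<Rightarrow> bool"
  where
  "tw_system b g \<sigma> i1 s \<phi> \<gamma> v p \<eta> \<longleftrightarrow>
     \<eta> \<in> sobolev_torus_cont (real s + 3/2) \<and> (\<forall>x. - b < \<eta> x) \<and>
     v \<in> sobolev0_sigma b \<eta> (s + 1) \<and> p \<in> sobolev_Omega b \<eta> s \<and>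
     stokes_solution b \<eta> (surface_stress g \<sigma> \<phi> \<eta>) v p \<and>
     (AE x in lebesgue. trace_top \<eta> v x \<bullet> normal_vec \<eta> x = - \<gamma> * pd i1 \<eta> x)"

text \<open>The product space carries the sum norm.\<close>

definition in_tw_ball ::
    "real \<Rightarrow> nat \<Rightarrow> (real ^ 'n \<Rightarrow> real) \<Rightarrow> real \<Rightarrow>
     ((real ^ 'n) \<times> real \<Rightarrow> (real ^ 'n) \<times> real) \<Rightarrow> ((real ^ 'n) \<times> real \<Rightarrow> real) \<Rightarrow> (real ^ 'n \<Rightarrow> real) \<Rightarrow> bool"
  where
  "in_tw_ball b s \<eta>s \<delta> v p \<eta> \<longleftrightarrow>
     norm_Omega_vec b \<eta> (s + 1) v + norm_Omega b \<eta> s p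
       + norm_torus (real s + 3/2) (\<lambda>x. \<eta> x - \<eta>s x) < \<delta>"

text \<open>
  \<open>\<delta>0\<close> is the threshold for the radius and \<open>\<gamma>d \<delta>\<close> the bound on the speed. Uniqueness is
  required among solutions with the same mean of \<open>\<eta>\<close>. Without fixing the mean it fails: already
  for \<open>\<gamma> = 0\<close>, for every small constant \<open>c\<close>, \<open>v = 0\<close>, \<open>p = c\<close> and the \<open>\<eta>\<close> with
  \<open>\<sigma> H(\<eta>) + g \<eta> + \<phi> = c\<close> solve the system.
\<close>

definition existence_fact ::
    "real \<Rightarrow> real \<Rightarrow> real \<Rightarrow> 'n \<Rightarrow> nat \<Rightarrow> (real ^ 'n \<Rightarrow> real) \<Rightarrow> (real ^ 'n \<Rightarrow> real)
      \<Rightarrow> real \<Rightarrow> (real \<Rightarrow> real) \<Rightarrow> bool" where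
  "existence_fact b g \<sigma> i1 s \<phi> \<eta>s \<delta>0 \<gamma>d \<longleftrightarrow>
     \<delta>0 > 0 \<and>
     (\<forall>\<delta>. 0 < \<delta> \<and> \<delta> < \<delta>0 \<longrightarrow> \<gamma>d \<delta> > 0 \<and>
        (\<forall>\<gamma>. \<bar>\<gamma>\<bar> < \<gamma>d \<delta> \<longrightarrow>
           (\<exists>v p \<eta>. tw_system b g \<sigma> i1 s \<phi> \<gamma> v p \<eta> \<and> in_tw_ball b s \<eta>s \<delta> v p \<eta>) \<and>
           (\<forall>v p \<eta> v' p' \<eta>'.
              tw_system b g \<sigma> i1 s \<phi> \<gamma> v p \<eta> \<and> in_tw_ball b s \<eta>s \<delta> v p \<eta> \<and>
              tw_system b g \<sigma> i1 s \<phi> \<gamma> v' p' \<eta>' \<and> in_tw_ball b s \<eta>s \<delta> v' p' \<eta>' \<and>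
              mean_torus \<eta> = mean_torus \<eta>' \<longrightarrow>
              \<eta>' = \<eta> \<and> (AE z in lebesgue_on (Omega b \<eta>). v' z = v z \<and> p' z = p z))))"

definition stability_fact ::
    "real \<Rightarrow> real \<Rightarrow> real \<Rightarrow> 'n \<Rightarrow> nat \<Rightarrow> (real ^ 'n \<Rightarrow> real) \<Rightarrow> (real ^ 'n \<Rightarrow> real)
      \<Rightarrow> real \<Rightarrow> (real \<Rightarrow> real) \<Rightarrow> bool" where
  "stability_fact b g \<sigma> i1 s \<phi> \<eta>s \<gamma>dag \<omega> \<longleftrightarrow>
     \<gamma>dag > 0 \<and> (\<forall>r\<ge>0. \<omega> r \<ge> 0) \<and> antimono_on {0..} \<omega> \<and>
     (\<forall>\<gamma> \<eta>w.
        \<eta>w \<in> sobolev_torus_cont (real s + 3/2) \<and> traveling_wave b g \<sigma> i1 \<phi> \<gamma> \<eta>w \<and>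
        - \<gamma>dag < \<gamma> \<and> \<gamma> < \<gamma>dag \<and>
        norm_torus (real s + 3/2) (\<lambda>x. \<eta>w x - \<eta>s x) \<le> \<omega> (norm_torus (real s + 3/2) \<eta>w) \<longrightarrow>
        asymptotically_stable b g \<sigma> i1 s \<phi> \<gamma> \<eta>w)"

end

theory Submission
  imports Defs
begin

text \<open>The stability fact tolerates a distance \<open>\<omega>\<close> evaluated at the norm of
  \<open>\<eta>w\<close>, while the hypothesis controls \<open>\<omega>\<close> only at a bound
  independent of the wave. The triangle inequality links the two: \<open>\<eta>w\<close> lies within
  \<delta>, hence within the threshold radius, of \<open>\<eta>s\<close>, so its norm is at most
  that radius plus the norm of \<open>\<eta>s\<close>. As \<omega> is nonincreasing, its value at
  the norm of \<open>\<eta>w\<close> is no smaller than its value at this bound, which exceeds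
  \<delta>. Also, the kinematic condition of the traveling wave system says that the right-hand side
  of the dynamic problem vanishes, so the wave is a stationary solution
  (\<open>tw_system_imp_traveling_wave\<close>). The analytic work is the triangle inequality for
  the Fourier-side norm, \<open>norm_torus_triangle_diff\<close>.\<close>

lemma integrable_times_cis:
  fixes f :: "real ^ 'n \<Rightarrow> real"
  assumes "f \<in> sobolev_torus r"
  shows "integrable (lebesgue_on cell) (\<lambda>x. complex_of_real (f x) * cis (- (u \<bullet> x)))"
proof -
  have cell: "cell \<in> lmeasurable"
    by (simp add: cell_def)
  have meas: "f \<in> borel_measurable (lebesgue_on cell)"
    and sq: "integrable (lebesgue_on cell) (\<lambda>x. (f x)\<^sup>2)"
    using assms by (auto simp: sobolev_torus_def intro: measurable_restrict_space1)
  have one: "integrable (lebesgue_on cell) (\<lambda>x. 1 :: real)"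
    using finite_measure_lebesgue_on[OF cell] by (rule finite_measure.integrable_const)
  have "continuous_on UNIV (\<lambda>x. cis (- (u \<bullet> x)))"
    by (intro continuous_intros)
  then have cis: "(\<lambda>x. cis (- (u \<bullet> x))) \<in> borel_measurable (lebesgue_on cell)"
    using cell by (intro continuous_imp_measurable_on_sets_lebesgue)
      (auto intro: continuous_on_subset)
  show ?thesis
  \<comment> \<open>The exponential has modulus 1 and \<bar>f\<bar> \<le> 1 + f^2, which is
    integrable because the cell has finite measure.\<close>
  proof (rule Bochner_Integration.integrable_bound)
    show "integrable (lebesgue_on cell) (\<lambda>x. 1 + (f x)\<^sup>2)"
      using one sq by (rule Bochner_Integration.integrable_add)
    show "(\<lambda>x. complex_of_real (f x) * cis (- (u \<bullet> x))) \<in> borel_measurable (lebesgue_on cell)"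
      using meas cis by measurable
    have "\<bar>f x\<bar> \<le> 1 + (f x)\<^sup>2" for x
      using sum_squares_bound[of 1 "\<bar>f x\<bar>"] by simp
    then show "AE x in lebesgue_on cell.
        norm (complex_of_real (f x) * cis (- (u \<bullet> x))) \<le> norm (1 + (f x)\<^sup>2)"
      by (simp add: norm_mult)
  qed
qed

text \<open>Bochner integrals subtract only for integrable functions, a nonintegrable one having
  integral 0 by convention; membership in the Sobolev spaces supplies the integrability.\<close>

lemma fourier_coeff_diff:
  assumes "f \<in> sobolev_torus r" and "h \<in> sobolev_torus r'"
  shows "fourier_coeff (\<lambda>x. f x - h x) k = fourier_coeff f k - fourier_coeff h k"
  by (simp add: fourier_coeff_def left_diff_distrib diff_divide_distrib
      Bochner_Integration.integral_diff[OF integrable_times_cis integrable_times_cis, OF assms])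

lemma sobolev_weight_mono:
  "r \<le> r' \<Longrightarrow> sobolev_weight r f k \<le> sobolev_weight r' f k"
  unfolding sobolev_weight_def by (intro mult_right_mono powr_mono) auto

lemma sobolev_weight_nonneg: "sobolev_weight r f k \<ge> 0"
  by (simp add: sobolev_weight_def)

lemma norm_torus_nonneg: "norm_torus r f \<ge> 0"
  by (simp add: norm_torus_def infsum_nonneg sobolev_weight_nonneg)

lemma sobolev_torus_antimono:
  assumes "r \<le> r'"
  shows "sobolev_torus r' \<subseteq> sobolev_torus r"
  unfolding sobolev_torus_def
  by (auto intro: summable_on_comparison_test sobolev_weight_mono[OF assms] sobolev_weight_nonneg)

text \<open>The norm is a weighted l2 norm of the Fourier coefficients, so this is Minkowski's
  inequality on finite sets of frequencies, followed by passage to the infinite sum.\<close>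

lemma norm_torus_triangle_diff:
  assumes f: "f \<in> sobolev_torus r" and h: "h \<in> sobolev_torus r"
  shows "norm_torus r f \<le> norm_torus r (\<lambda>x. f x - h x) + norm_torus r h"
proof -
  let ?d = "\<lambda>x. f x - h x"
  \<comment> \<open>The square root of the Sobolev weight, so that \<open>L2_set\<close> of
    \<open>a q\<close> gives the truncated norm.\<close>
  define a where "a q k = (1 + (norm (freq k))\<^sup>2) powr (r / 2) * cmod (fourier_coeff q k)"
    for q :: "real ^ 'a \<Rightarrow> real" and k
  have weight: "sobolev_weight r q k = (a q k)\<^sup>2" for q k
    by (simp add: sobolev_weight_def a_def power_mult_distrib power2_eq_square[of "_ powr _"]
        flip: powr_add)
  have a_nonneg: "a q k \<ge> 0" for q k
    by (simp add: a_def)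
  have coeff: "fourier_coeff ?d k = fourier_coeff f k - fourier_coeff h k" for k
    using fourier_coeff_diff[OF f h] .
  have sf: "sobolev_weight r f summable_on UNIV" and sh: "sobolev_weight r h summable_on UNIV"
    using f h by (auto simp: sobolev_torus_def)
  \<comment> \<open>Without summability the infinite sum would default to 0 and not dominate its
    finite parts. It follows from (x + y)^2 \<le> 2 (x^2 + y^2).\<close>
  have sd: "sobolev_weight r ?d summable_on UNIV"
  proof (rule summable_on_comparison_test)
    show "(\<lambda>k. 2 * (sobolev_weight r f k + sobolev_weight r h k)) summable_on UNIV"
      using sf sh by (intro summable_on_cmult_right summable_on_add)
    fix k
    have "a ?d k \<le> a f k + a h k"
      unfolding a_def coeff distrib_left[symmetric]
      by (intro mult_left_mono norm_triangle_ineq4) auto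
    then have "(a ?d k)\<^sup>2 \<le> (a f k + a h k)\<^sup>2"
      by (intro power_mono a_nonneg)
    also have "\<dots> \<le> 2 * ((a f k)\<^sup>2 + (a h k)\<^sup>2)"
      using sum_squares_bound[of "a f k" "a h k"] by (simp add: power2_sum)
    finally show "sobolev_weight r ?d k \<le> 2 * (sobolev_weight r f k + sobolev_weight r h k)"
      by (simp add: weight)
  qed (rule sobolev_weight_nonneg)
  have a_le: "a f k \<le> a ?d k + a h k" for k
    using norm_triangle_sub[of "fourier_coeff f k" "fourier_coeff h k"]
    unfolding a_def coeff distrib_left[symmetric] by (intro mult_left_mono) auto
  have L2_le: "L2_set (a q) F \<le> norm_torus r q"
    if "sobolev_weight r q summable_on UNIV" "finite F" for q F
    unfolding L2_set_def norm_torus_def weight[symmetric]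
    using that by (intro real_sqrt_le_mono finite_sum_le_infsum) (auto simp: sobolev_weight_nonneg)
  have "(\<Sum>\<^sub>\<infinity>k. sobolev_weight r f k) \<le> (norm_torus r ?d + norm_torus r h)\<^sup>2"
  proof (rule infsum_le_finite_sums[OF sf])
    fix F :: "(int ^ 'a) set" assume F: "finite F"
    have "L2_set (a f) F \<le> L2_set (\<lambda>k. a ?d k + a h k) F"
      by (intro L2_set_mono a_le a_nonneg)
    also have "\<dots> \<le> L2_set (a ?d) F + L2_set (a h) F"
      by (rule L2_set_triangle_ineq)
    also have "\<dots> \<le> norm_torus r ?d + norm_torus r h"
      by (intro add_mono L2_le sd sh F)
    finally show "sum (sobolev_weight r f) F \<le> (norm_torus r ?d + norm_torus r h)\<^sup>2"
      unfolding L2_set_def weight by (rule sqrt_le_D)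
  qed
  then show ?thesis
    unfolding norm_torus_def[of r f]
    by (intro real_le_lsqrt add_nonneg_nonneg norm_torus_nonneg)
qed

lemma tw_system_imp_traveling_wave:
  assumes "tw_system b g \<sigma> i1 s \<phi> \<gamma> v p \<eta>"
  shows "traveling_wave b g \<sigma> i1 \<phi> \<gamma> \<eta>"
proof -
  \<comment> \<open>\<open>is_Psi0\<close> determines \<open>\<psi>\<close> only almost everywhere, so it may be taken to be \<open>- \<gamma> \<partial>\<^sub>1 \<eta>\<close>
    everywhere, and the right-hand side of the dynamic problem is then identically zero.\<close>
  have "is_Psi0 b \<eta> (surface_stress g \<sigma> \<phi> \<eta>) (\<lambda>x. - \<gamma> * pd i1 \<eta> x)"
    using assms unfolding tw_system_def is_Psi0_def by (auto elim: eventually_mono)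
  then have "\<exists>\<psi>. is_Psi0 b \<eta> (surface_stress g \<sigma> \<phi> \<eta>) \<psi> \<and> (\<forall>x. 0 = \<gamma> * pd i1 \<eta> x + \<psi> x)"
    by force
  moreover have "\<forall>x. - b < \<eta> x"
    using assms by (simp add: tw_system_def)
  ultimately show ?thesis
    unfolding traveling_wave_def dynamic_solution_def
    by (intro allI impI conjI exI[where x = "\<lambda>_ _. 0"]) auto
qed

theorem corollary1p3:
  fixes b g \<sigma> :: real
    and i1 :: "'n::finite"
    and s :: nat
    and \<phi> \<eta>s \<eta>w :: "real ^ 'n \<Rightarrow> real"
    and v :: "(real ^ 'n) \<times> real \<Rightarrow> (real ^ 'n) \<times> real"
    and p :: "(real ^ 'n) \<times> real \<Rightarrow> real"
    and \<delta>0 \<gamma>d \<omega> :: "real \<Rightarrow> real"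
    and \<gamma>dag \<gamma> \<delta> :: real
  assumes "b > 0" and "g > 0" and "\<sigma> > 0"
    and "real s > (real CARD('n) + 1) / 2 + 1"
    and "\<phi> \<in> sobolev_torus_cont (real s + 1/2)"
    and "(INF x. - \<phi> x) > - (g * b)"
    and "\<eta>s \<in> sobolev_torus_cont (real s + 5/2)"
    and "\<forall>x. \<sigma> * mean_curv \<eta>s x + g * \<eta>s x = - \<phi> x"
    and "existence_fact b g \<sigma> i1 s \<phi> \<eta>s (\<delta>0 (norm_torus (real s - 1/2) \<phi>)) \<gamma>d"
    and "stability_fact b g \<sigma> i1 s \<phi> \<eta>s \<gamma>dag \<omega>"
    and "0 < \<delta>"
    and "tw_system b g \<sigma> i1 s \<phi> \<gamma> v p \<eta>w"
    and "in_tw_ball b s \<eta>s \<delta> v p \<eta>w"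
    and "norm_torus (real s + 3/2) (\<lambda>x. \<eta>w x - \<eta>s x) < \<delta>"
    and "\<delta> < min (\<delta>0 (norm_torus (real s - 1/2) \<phi>))
                 (\<omega> (\<delta>0 (norm_torus (real s - 1/2) \<phi>) + norm_torus (real s + 3/2) \<eta>s))"
    and "\<bar>\<gamma>\<bar> < min (\<gamma>d \<delta>) \<gamma>dag"
  shows "asymptotically_stable b g \<sigma> i1 s \<phi> \<gamma> \<eta>w"
proof -
  let ?r = "real s + 3/2" and ?\<delta>0 = "\<delta>0 (norm_torus (real s - 1/2) \<phi>)"
  have \<eta>w: "\<eta>w \<in> sobolev_torus_cont ?r"
    using \<open>tw_system b g \<sigma> i1 s \<phi> \<gamma> v p \<eta>w\<close> by (simp add: tw_system_def)
  have "\<eta>w \<in> sobolev_torus ?r"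
    using \<eta>w by (simp add: sobolev_torus_cont_def)
  \<comment> \<open>The equilibrium is one order smoother than the norm in use.\<close>
  moreover have "\<eta>s \<in> sobolev_torus ?r"
    using \<open>\<eta>s \<in> _\<close> sobolev_torus_antimono[of ?r "real s + 5/2"]
    by (auto simp: sobolev_torus_cont_def)
  ultimately have "norm_torus ?r \<eta>w \<le> norm_torus ?r (\<lambda>x. \<eta>w x - \<eta>s x) + norm_torus ?r \<eta>s"
    by (rule norm_torus_triangle_diff)
  \<comment> \<open>The distance is below \<delta>, and \<delta> is below the threshold of the
    existence fact.\<close>
  also have "\<dots> \<le> ?\<delta>0 + norm_torus ?r \<eta>s"
    using assms(14,15) by simp
  finally have le: "norm_torus ?r \<eta>w \<le> ?\<delta>0 + norm_torus ?r \<eta>s" .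
  have "antimono_on {0..} \<omega>"
    using \<open>stability_fact _ _ _ _ _ _ _ _ _\<close> by (simp add: stability_fact_def)
  \<comment> \<open>Monotonicity is only given on nonnegative arguments, hence the appeal to
    nonnegativity of the norm.\<close>
  then have "\<omega> (?\<delta>0 + norm_torus ?r \<eta>s) \<le> \<omega> (norm_torus ?r \<eta>w)"
    using le norm_torus_nonneg[of ?r \<eta>w] by (simp add: monotone_on_def)
  then have "norm_torus ?r (\<lambda>x. \<eta>w x - \<eta>s x) \<le> \<omega> (norm_torus ?r \<eta>w)"
    using assms(14,15) by simp
  moreover have "traveling_wave b g \<sigma> i1 \<phi> \<gamma> \<eta>w"
    by (rule tw_system_imp_traveling_wave) fact
  moreover have "- \<gamma>dag < \<gamma>" and "\<gamma> < \<gamma>dag"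
    using assms(16) by auto
  ultimately show ?thesis
    using \<eta>w \<open>stability_fact _ _ _ _ _ _ _ _ _\<close> unfolding stability_fact_def by blast
qed

end
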